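(* For all $p\ge3$ and $q\ge2$ the surface $\Sigma_{p,2q}$ can be realized in $\mathbb{R}^5$; that is, there is a polytopal complex in $\mathbb{R}^5$ (composed of planar convex $p$-gons, their edges and vertices, any two of its cells intersecting in a common, possibly empty, face) that is combinatorially isomorphic to $\Sigma_{p,2q}$.
   Context: Notation: $[n]=\{0,1,\dots,n-1\}$. Let $C_p=\{x\in\mathbb{R}^2 : a_ix\le1,\ i\in[p]\}$ be a convex $p$-gon with its $p$ edges labeled in cyclic order, and $\Delta_{q-1}=\{y\in\mathbb{R}^{q-1} : b_jy\le1,\ j\in[q]\}$ a $(q-1)$-simplex (both given by their facet inequalities). The wedge product is the polytope $$\mathcal{W}_{p,q-1}=C_p\triangleleft\Delta_{q-1}=\{(x,y_0,\dots,y_{p-1})\in\mathbb{R}^{2+p(q-1)} : a_ix+b_jy_i\le1\ \text{for all } i\in[p],\ j\in[q]\},$$ with facet hyperplanes $h_{i,j}: a_ix+b_jy_i=1$. A face $G$ is denoted by the vector $(H_0,\dots,H_{p-1})$, $H_i\subseteq[q]$, where $j\in H_i\iff G\subset h_{i,j}$. For $j\in[q]$ write $\overline{j}=[q]\setminus\{j\}$. All vectors $(\overline{j_0},\dots,\overline{j_{p-1}})$ with $j_k\in[q]$ denote faces that are $p$-gons. $\Sigma_{p,2q}$ is the polytopal subcomplex of the boundary of $\mathcal{W}_{p,q-1}$ consisting of the $p$-gon faces $(\overline{j_0},\dots,\overline{j_{p-1}})$ with $\sum_{k=0}^{p-1}j_k\equiv 0$ or $1 \pmod q$, together with all their edges and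 vertices. It is a closed connected orientable $2$-manifold. *)

theory Defs
  imports "HOL-Analysis.Analysis" "HOL-Number_Theory.Cong"
begin

section \<open>Polytopes given by facet inequalities\<close>

definition hpolyhedron :: "(nat \<Rightarrow> 'a::euclidean_space) \<Rightarrow> nat \<Rightarrow> 'a set" where
  "hpolyhedron c n = {x. \<forall>i<n. c i \<bullet> x \<le> 1}"

definition hfacet :: "(nat \<Rightarrow> 'a::euclidean_space) \<Rightarrow> nat \<Rightarrow> nat \<Rightarrow> 'a set" where
  "hfacet c n i = hpolyhedron c n \<inter> {x. c i \<bullet> x = 1}"

text \<open>The inequalities correspond one-to-one to the facets; in particular none is redundant.\<close>

definition facet_inequalities :: "(nat \<Rightarrow> 'a::euclidean_space) \<Rightarrow> nat \<Rightarrow> bool" where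
  "facet_inequalities c n \<longleftrightarrow> bij_betw (hfacet c n) {..<n} {F. F facet_of hpolyhedron c n}"

definition convex_polygon :: "nat \<Rightarrow> 'a::euclidean_space set \<Rightarrow> bool" where
  "convex_polygon n P \<longleftrightarrow> polytope P \<and> aff_dim P = 2 \<and> card {v. v extreme_point_of P} = n"

definition cyclically_labeled :: "(nat \<Rightarrow> 'a::euclidean_space) \<Rightarrow> nat \<Rightarrow> bool" where
  "cyclically_labeled a p \<longleftrightarrow> (\<forall>i<p. hfacet a p i \<inter> hfacet a p (Suc i mod p) \<noteq> {})"

section \<open>The wedge product of a polygon and a simplex\<close>

text \<open>The space of all \<open>(x, y\<^sub>0, \<dots>, y\<^sub>p\<^sub>-\<^sub>1)\<close> is rendered as \<open>(real^2) \<times> (real^'m^'p)\<close>,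
  where \<open>CARD('m) = q - 1\<close> and \<open>CARD('p) = p\<close>.  The bijection \<open>e\<close> from \<open>{..<p}\<close>
  to \<open>'p\<close> numbers the blocks: \<open>y\<^sub>i\<close> is \<open>y $ e i\<close>.\<close>

definition wedge_product ::
  "(nat \<Rightarrow> 'p::finite) \<Rightarrow> nat \<Rightarrow> nat \<Rightarrow> (nat \<Rightarrow> real^2) \<Rightarrow> (nat \<Rightarrow> real^'m)
    \<Rightarrow> ((real^2) \<times> (real^'m^'p)) set" where
  "wedge_product e p q a b = {(x, y). \<forall>i<p. \<forall>j<q. a i \<bullet> x + b j \<bullet> (y $ e i) \<le> 1}"

definition wedge_hyperplane ::
  "(nat \<Rightarrow> 'p::finite) \<Rightarrow> (nat \<Rightarrow> real^2) \<Rightarrow> (nat \<Rightarrow> real^'m) \<Rightarrow> nat \<Rightarrow> nat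
    \<Rightarrow> ((real^2) \<times> (real^'m^'p)) set" where
  "wedge_hyperplane e a b i j = {(x, y). a i \<bullet> x + b j \<bullet> (y $ e i) = 1}"

text \<open>The entry \<open>H\<^sub>i\<close> of the vector denoting the face \<open>G\<close>.\<close>

definition face_entry ::
  "(nat \<Rightarrow> 'p::finite) \<Rightarrow> nat \<Rightarrow> (nat \<Rightarrow> real^2) \<Rightarrow> (nat \<Rightarrow> real^'m)
    \<Rightarrow> ((real^2) \<times> (real^'m^'p)) set \<Rightarrow> nat \<Rightarrow> nat set" where
  "face_entry e q a b G i = {j. j < q \<and> G \<subseteq> wedge_hyperplane e a b i j}"

definition surface_polygons ::
  "(nat \<Rightarrow> 'p::finite) \<Rightarrow> nat \<Rightarrow> nat \<Rightarrow> (nat \<Rightarrow> real^2) \<Rightarrow> (nat \<Rightarrow> real^'m)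
    \<Rightarrow> ((real^2) \<times> (real^'m^'p)) set set" where
  "surface_polygons e p q a b =
    {G. G face_of wedge_product e p q a b \<and>
        (\<exists>j::nat \<Rightarrow> nat. (\<forall>k<p. j k < q) \<and>
             ([(\<Sum>k<p. j k) = 0] (mod q) \<or> [(\<Sum>k<p. j k) = 1] (mod q)) \<and>
             (\<forall>k<p. face_entry e q a b G k = {..<q} - {j k}))}"

text \<open>The polygons with all their edges and vertices.  As usual for polytopal complexes,
  the empty face is counted as a cell, here and in \<open>polytopal_complex\<close> below.\<close>

definition surface ::
  "(nat \<Rightarrow> 'p::finite) \<Rightarrow> nat \<Rightarrow> nat \<Rightarrow> (nat \<Rightarrow> real^2) \<Rightarrow> (nat \<Rightarrow> real^'m)
    \<Rightarrow> ((real^2) \<times> (real^'m^'p)) set set" where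
  "surface e p q a b = {F. \<exists>G \<in> surface_polygons e p q a b. F face_of G}"

section \<open>Polytopal complexes\<close>

definition polytopal_complex :: "'a::euclidean_space set set \<Rightarrow> bool" where
  "polytopal_complex K \<longleftrightarrow>
     finite K \<and>
     (\<forall>S\<in>K. polytope S) \<and>
     (\<forall>S\<in>K. \<forall>F. F face_of S \<longrightarrow> F \<in> K) \<and>
     (\<forall>S\<in>K. \<forall>T\<in>K. (S \<inter> T) face_of S \<and> (S \<inter> T) face_of T)"

text \<open>Isomorphism of the face posets.\<close>

definition combinatorially_isomorphic :: "'a set set \<Rightarrow> 'b set set \<Rightarrow> bool" where
  "combinatorially_isomorphic K L \<longleftrightarrow>
     (\<exists>f. bij_betw f K L \<and> (\<forall>S\<in>K. \<forall>T\<in>K. S \<subseteq> T \<longleftrightarrow> f S \<subseteq> f T))"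

end

theory Submission imports Defs begin

text \<open>A face of the wedge product with vector \<open>(\<bar>j\<^sub>0, \<dots>, \<bar>j\<^sub>p\<^sub>-\<^sub>1)\<close> is the graph over the polygon of
  the affine map \<open>x \<mapsto> ((1 - a\<^sub>k x) v\<^bsub>j\<^sub>k\<^esub>)\<^sub>k\<close>, where \<open>v\<^sub>j\<close> is the vertex of the simplex opposite to
  its \<open>j\<close>-th facet; so it is a \<open>p\<close>-gon, and the surface is a 2-dimensional polytopal complex.
  The differences of points from two planes lie in a linear subspace of dimension at most 5,
  so a generic linear map to \<open>\<real>\<^sup>5\<close> is injective on the union of the affine hulls of all the
  cells and therefore carries the complex to an isomorphic one.\<close>

section \<open>Generic linear maps\<close>

text \<open>Each \<open>u\<close> in \<open>U\<close> excludes one hyperplane of vectors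
  \<open>v\<close>. Finitely many hyperplanes form a negligible set, so some vector lies on none of
  them.\<close>

lemma exists_inner_nonzero:
  fixes U :: "'a::euclidean_space set"
  assumes "finite U" "0 \<notin> U"
  shows "\<exists>v. \<forall>u\<in>U. u \<bullet> v \<noteq> 0"
proof -
  have "negligible (\<Union>u\<in>U. {v. u \<bullet> v = 0})"
    using assms by (intro negligible_Union) (auto intro!: negligible_hyperplane)
  then have "(\<Union>u\<in>U. {v. u \<bullet> v = 0}) \<noteq> UNIV"
    using non_negligible_UNIV by metis
  then show ?thesis by auto
qed

text \<open>As many functionals as the largest dimension in the family suffice, whatever the ambient
  dimension. A generic \<open>w\<close> is nonzero on a chosen vector of every nonzero subspace, so
  its kernel \<open>H\<close> lowers all their dimensions at once; induction handles the traces on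
  \<open>H\<close>.\<close>

lemma exists_separating_functionals:
  fixes F :: "'a::euclidean_space set set"
  assumes "finite F" "\<And>S. S \<in> F \<Longrightarrow> subspace S" "\<And>S. S \<in> F \<Longrightarrow> dim S \<le> n"
  shows "\<exists>v::nat \<Rightarrow> 'a. \<forall>S\<in>F. \<forall>x\<in>S. (\<forall>i<n. v i \<bullet> x = 0) \<longrightarrow> x = 0"
  using assms
proof (induction n arbitrary: F)
  case 0
  then show ?case by auto
next
  case (Suc n)
  define u where "u S = (SOME x. x \<in> S \<and> x \<noteq> 0)" for S :: "'a set"
  have u: "u S \<in> S \<and> u S \<noteq> 0" if "x \<in> S" "x \<noteq> 0" for S x
    unfolding u_def by (rule someI [of _ x]) (use that in simp)
  obtain w where w: "\<And>S. S \<in> F \<Longrightarrow> u S \<noteq> 0 \<Longrightarrow> u S \<bullet> w \<noteq> 0"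
    using exists_inner_nonzero [of "u ` F - {0}"] Suc.prems(1) by auto
  define H where "H = {x. w \<bullet> x = 0}"
  have H: "subspace H" unfolding H_def by (rule subspace_hyperplane)
  have "dim (S \<inter> H) \<le> n" if S: "S \<in> F" for S
  proof (cases "S \<subseteq> {0}")
    case True
    then show ?thesis by (metis dim_eq_0 inf.coboundedI1 le0)
  next
    case False
    then obtain x where "x \<in> S" "x \<noteq> 0" by blast
    from u [OF this] w [OF S] have "u S \<in> S" "u S \<notin> S \<inter> H"
      unfolding H_def by (auto simp: inner_commute)
    then have "S \<inter> H \<noteq> S" by blast
    then have "dim (S \<inter> H) \<noteq> dim S"
      using subspace_dim_equal [of "S \<inter> H" S] Suc.prems(2) [OF S] H
      by (auto simp: subspace_inter)
    moreover have "dim (S \<inter> H) \<le> dim S" by (simp add: dim_subset)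
    ultimately show ?thesis using Suc.prems(3) [OF S] by linarith
  qed
  then have "\<exists>v::nat \<Rightarrow> 'a. \<forall>S\<in>(\<lambda>S. S \<inter> H) ` F. \<forall>x\<in>S. (\<forall>i<n. v i \<bullet> x = 0) \<longrightarrow> x = 0"
    using Suc.prems(1,2) H by (intro Suc.IH) (auto simp: subspace_inter)
  then obtain v :: "nat \<Rightarrow> 'a"
    where v: "\<And>S x. S \<in> F \<Longrightarrow> x \<in> S \<Longrightarrow> x \<in> H \<Longrightarrow> (\<forall>i<n. v i \<bullet> x = 0) \<Longrightarrow> x = 0"
    by auto
  show ?case
    \<comment> \<open>Index \<open>n\<close> is free, since \<open>v\<close> is used only below
      \<open>n\<close>. The vanishing of \<open>w\<close> places the vector in \<open>H\<close>, and
      the other functionals then kill it.\<close>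
    by (rule exI [of _ "v(n := w)"]) (use v in \<open>fastforce simp: less_Suc_eq H_def\<close>)
qed

text \<open>The separating functionals become the coordinates of one map; \<open>h\<close> numbers
  the index type \<open>'n\<close>.\<close>

lemma exists_linear_trivial_kernel:
  fixes F :: "'a::euclidean_space set set"
  assumes "finite F" "\<And>S. S \<in> F \<Longrightarrow> subspace S" "\<And>S. S \<in> F \<Longrightarrow> dim S \<le> CARD('n)"
  shows "\<exists>f::'a \<Rightarrow> real^'n. linear f \<and> (\<forall>S\<in>F. \<forall>x\<in>S. f x = 0 \<longrightarrow> x = 0)"
proof -
  obtain v :: "nat \<Rightarrow> 'a"
    where v: "\<And>S x. S \<in> F \<Longrightarrow> x \<in> S \<Longrightarrow> (\<forall>i<CARD('n). v i \<bullet> x = 0) \<Longrightarrow> x = 0"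
    using exists_separating_functionals [OF assms] by blast
  obtain h :: "'n \<Rightarrow> nat" where h: "bij_betw h UNIV {0..<CARD('n)}"
    using ex_bij_betw_finite_nat [of "UNIV :: 'n set"] by auto
  define f where "f x = (\<chi> i. v (h i) \<bullet> x)" for x
  have "linear f"
    unfolding f_def by (rule linearI) (auto simp: vec_eq_iff inner_add_right)
  moreover have "x = 0" if "S \<in> F" "x \<in> S" "f x = 0" for S x
  proof (rule v [OF that(1,2)], intro allI impI)
    fix i assume "i < CARD('n)"
    then obtain k where "i = h k"
      using h by (metis atLeastLessThan_iff bij_betw_imp_surj_on imageE le0)
    then show "v i \<bullet> x = 0" using that(3) by (simp add: f_def vec_eq_iff)
  qed
  ultimately show ?thesis by blast
qed

text \<open>Source of the number 5: by \<open>x - y = (x - a) - (y - b) + (a - b)\<close>, all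
  differences are spanned by a basis of each direction space, at most \<open>d\<close> vectors each,
  and the single vector \<open>a - b\<close>.\<close>

lemma affine_hull_differences_subspace:
  fixes S T :: "'a::euclidean_space set"
  assumes "aff_dim S \<le> int d" "aff_dim T \<le> int d"
  shows "\<exists>U. subspace U \<and> dim U \<le> 2 * d + 1 \<and> (\<forall>x\<in>affine hull S. \<forall>y\<in>affine hull T. x - y \<in> U)"
proof (cases "S = {} \<or> T = {}")
  case True
  then show ?thesis by (intro exI [of _ "{0}"]) auto
next
  case False
  then obtain a b where ab: "a \<in> S" "b \<in> T" by blast
  have basis: "\<exists>B. finite B \<and> card B \<le> d \<and> (\<forall>x\<in>affine hull R. x - c \<in> span B)"
    if "c \<in> R" "aff_dim R \<le> int d" for R :: "'a set" and c
  proof -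
    let ?A = "(\<lambda>x. x - c) ` R"
    obtain B where B: "B \<subseteq> ?A" "independent B" "?A \<subseteq> span B" "card B = dim ?A"
      using basis_exists [of ?A] by blast
    have "(\<lambda>x. x - c) ` (affine hull R) = span ?A"
      by (rule diffs_affine_hull_span [OF that(1)])
    moreover have "span ?A \<subseteq> span B" using B(3) by (simp add: span_minimal)
    moreover have "int (dim ?A) \<le> int d"
      using aff_dim_eq_dim_subtract [of c R] that by (simp add: hull_inc)
    ultimately show ?thesis using B independent_imp_finite
      by (intro exI [of _ B]) auto
  qed
  obtain B where B: "finite B" "card B \<le> d" "\<And>x. x \<in> affine hull S \<Longrightarrow> x - a \<in> span B"
    using basis [OF ab(1) assms(1)] by blast
  obtain C where C: "finite C" "card C \<le> d" "\<And>x. x \<in> affine hull T \<Longrightarrow> x - b \<in> span C"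
    using basis [OF ab(2) assms(2)] by blast
  define D where "D = insert (a - b) (B \<union> C)"
  have "card D \<le> Suc (card (B \<union> C))"
    using B C by (simp add: D_def card_insert_if)
  also have "\<dots> \<le> 2 * d + 1"
    using card_Un_le [of B C] B C by simp
  finally have "card D \<le> 2 * d + 1" .
  moreover have "dim (span D) \<le> card D"
    using dim_le_card [of "span D" D] B C by (simp add: D_def)
  moreover have "x - y \<in> span D" if "x \<in> affine hull S" "y \<in> affine hull T" for x y
  proof -
    have "x - a \<in> span D" "y - b \<in> span D" "a - b \<in> span D"
      using B(3) [OF that(1)] C(3) [OF that(2)] span_mono [of B D] span_mono [of C D]
      by (auto simp: D_def intro: span_base)
    then have "((x - a) - (y - b)) + (a - b) \<in> span D"
      using span_add span_diff by metis
    then show ?thesis by simp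
  qed
  ultimately show ?thesis by (intro exI [of _ "span D"]) auto
qed

text \<open>A map whose kernel meets every difference space \<open>U S T\<close> only in 0 cannot
  identify two points of the union. Working with affine hulls instead of the cells themselves also
  lets the images keep their dimension.\<close>

lemma exists_linear_inj_on_affine_hulls:
  fixes K :: "'a::euclidean_space set set"
  assumes "finite K" "\<And>S. S \<in> K \<Longrightarrow> aff_dim S \<le> int d" "2 * d + 1 \<le> CARD('n)"
  shows "\<exists>f::'a \<Rightarrow> real^'n. linear f \<and> inj_on f (\<Union>S\<in>K. affine hull S)"
proof -
  have "\<exists>U. subspace U \<and> dim U \<le> 2 * d + 1 \<and> (\<forall>x\<in>affine hull S. \<forall>y\<in>affine hull T. x - y \<in> U)"
    if "S \<in> K" "T \<in> K" for S T
    using affine_hull_differences_subspace assms(2) that by blast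
  then obtain U where U: "\<And>S T. S \<in> K \<Longrightarrow> T \<in> K \<Longrightarrow> subspace (U S T)"
      "\<And>S T. S \<in> K \<Longrightarrow> T \<in> K \<Longrightarrow> dim (U S T) \<le> 2 * d + 1"
      "\<And>S T x y. S \<in> K \<Longrightarrow> T \<in> K \<Longrightarrow> x \<in> affine hull S \<Longrightarrow> y \<in> affine hull T
        \<Longrightarrow> x - y \<in> U S T"
    by metis
  have "\<exists>f::'a \<Rightarrow> real^'n. linear f \<and> (\<forall>V\<in>(\<lambda>(S,T). U S T) ` (K \<times> K). \<forall>x\<in>V. f x = 0 \<longrightarrow> x = 0)"
    by (rule exists_linear_trivial_kernel) (use assms U in \<open>fastforce+\<close>)
  then obtain f :: "'a \<Rightarrow> real^'n" where f: "linear f"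
    and ker: "\<And>S T x. S \<in> K \<Longrightarrow> T \<in> K \<Longrightarrow> x \<in> U S T \<Longrightarrow> f x = 0 \<Longrightarrow> x = 0"
    by auto
  have "inj_on f (\<Union>S\<in>K. affine hull S)"
  proof (rule inj_onI, clarify)
    fix x y S T assume *: "f x = f y" "S \<in> K" "x \<in> affine hull S" "T \<in> K" "y \<in> affine hull T"
    then have "f (x - y) = 0" using f by (simp add: linear_diff)
    with ker [OF *(2,4) U(3)] * have "x - y = 0" by blast
    then show "x = y" by simp
  qed
  with f show ?thesis by blast
qed

section \<open>Linear images of polytopal complexes\<close>

text \<open>Linearity carries the parametrization of the segment along. Injectivity keeps distinct
  endpoints distinct, which matters because an open segment with equal endpoints is empty.\<close>

lemma open_segment_linear_image_inj_on:
  assumes "linear f" "inj_on f S" "a \<in> S" "b \<in> S"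
  shows "open_segment (f a) (f b) = f ` open_segment a b"
proof (cases "a = b")
  case False
  then have "f a \<noteq> f b" using assms by (auto dest: inj_onD)
  have "f ((1 - u) *\<^sub>R a + u *\<^sub>R b) = (1 - u) *\<^sub>R f a + u *\<^sub>R f b" for u
    using assms(1) by (simp add: linear_add linear_scale)
  then have "f ` (\<lambda>u. (1 - u) *\<^sub>R a + u *\<^sub>R b) ` {0<..<1} =
      (\<lambda>u. (1 - u) *\<^sub>R f a + u *\<^sub>R f b) ` {0<..<1}"
    by (simp add: image_image)
  with False \<open>f a \<noteq> f b\<close> show ?thesis
    by (simp add: open_segment_image_interval)
qed simp

text \<open>Faces are defined by open segments between points of \<open>S\<close>. By convexity
  these stay in \<open>S\<close>, so injectivity on \<open>S\<close> alone is enough to transfer the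
  condition in both directions.\<close>

lemma face_of_linear_image_inj_on:
  assumes f: "linear f" "inj_on f S" and S: "convex S" and T: "T \<subseteq> S"
  shows "f ` T face_of f ` S \<longleftrightarrow> T face_of S"
proof -
  have mem: "f x \<in> f ` R \<longleftrightarrow> x \<in> R" if "x \<in> S" "R \<subseteq> S" for x R
    using inj_on_image_mem_iff [OF f(2) that] .
  have seg: "open_segment x y \<subseteq> S" if "x \<in> S" "y \<in> S" for x y
    using S that by (meson convex_contains_open_segment)
  have segf: "open_segment (f x) (f y) = f ` open_segment x y" if "x \<in> S" "y \<in> S" for x y
    using open_segment_linear_image_inj_on [OF f that] .
  have "convex (f ` T) \<longleftrightarrow> convex T"
  proof
    assume c: "convex (f ` T)"
    show "convex T"
      unfolding convex_contains_open_segment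
    proof (intro ballI subsetI)
      fix x y z assume *: "x \<in> T" "y \<in> T" "z \<in> open_segment x y"
      then have "open_segment (f x) (f y) \<subseteq> f ` T"
        using c by (simp add: convex_contains_open_segment)
      then have "f z \<in> f ` T" using segf [of x y] * T by auto
      then show "z \<in> T" using mem [of z T] seg [of x y] * T by blast
    qed
  qed (use f in \<open>simp add: convex_linear_image\<close>)
  moreover have "(\<forall>x\<in>S. \<forall>y\<in>S. \<forall>z\<in>T. f z \<in> open_segment (f x) (f y) \<longrightarrow> f x \<in> f ` T \<and> f y \<in> f ` T)
     \<longleftrightarrow> (\<forall>x\<in>S. \<forall>y\<in>S. \<forall>z\<in>T. z \<in> open_segment x y \<longrightarrow> x \<in> T \<and> y \<in> T)"
  proof (intro ball_cong refl)
    fix x y z assume *: "x \<in> S" "y \<in> S" "z \<in> T"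
    have "f z \<in> open_segment (f x) (f y) \<longleftrightarrow> z \<in> open_segment x y"
      using * T mem [of z "open_segment x y"] seg [of x y] segf [of x y] by auto
    then show "(f z \<in> open_segment (f x) (f y) \<longrightarrow> f x \<in> f ` T \<and> f y \<in> f ` T) \<longleftrightarrow>
        (z \<in> open_segment x y \<longrightarrow> x \<in> T \<and> y \<in> T)"
      using mem [OF *(1) T] mem [OF *(2) T] by simp
  qed
  ultimately show ?thesis
    using T unfolding face_of_def by (simp add: image_mono)
qed

text \<open>Extreme points are the singleton faces, so their number is preserved by the transfer of
  faces. The dimension is preserved because \<open>f\<close> is injective on the direction space of
  the affine hull.\<close>

lemma convex_polygon_linear_image:
  fixes f :: "'a::euclidean_space \<Rightarrow> 'b::euclidean_space"
  assumes f: "linear f" "inj_on f (affine hull P)" and P: "convex_polygon n P"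
  shows "convex_polygon n (f ` P)"
proof -
  have inj: "inj_on f P" using f(2) by (meson hull_subset inj_on_subset)
  have poly: "polytope P" and dim: "aff_dim P = 2"
    and card: "card {v. v extreme_point_of P} = n"
    using P by (auto simp: convex_polygon_def)
  obtain c where c: "c \<in> P" using dim by fastforce
  let ?A = "(\<lambda>x. x - c) ` P"
  \<comment> \<open>Adding \<open>c\<close> moves the direction space \<open>span ?A\<close> onto
    the affine hull, where \<open>f\<close> is injective.\<close>
  have "inj_on f (span ?A)"
  proof (rule inj_onI)
    fix x y assume *: "x \<in> span ?A" "y \<in> span ?A" "f x = f y"
    then have "x + c \<in> affine hull P" "y + c \<in> affine hull P"
      using diffs_affine_hull_span [OF c, symmetric] by auto
    moreover have "f (x + c) = f (y + c)" using * f(1) by (simp add: linear_add)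
    ultimately show "x = y" using f(2) by (auto dest: inj_onD)
  qed
  then have "dim (f ` ?A) = dim ?A" by (rule dim_image_eq [OF f(1)])
  moreover have "f ` ?A = (\<lambda>x. x - f c) ` (f ` P)"
    using f(1) by (simp add: image_image linear_diff)
  ultimately have "aff_dim (f ` P) = aff_dim P"
    using aff_dim_eq_dim_subtract [of c P] aff_dim_eq_dim_subtract [of "f c" "f ` P"] c
    by (simp add: hull_inc)
  moreover have "{v. v extreme_point_of (f ` P)} = f ` {v. v extreme_point_of P}"
  proof -
    have "f v extreme_point_of (f ` P) \<longleftrightarrow> v extreme_point_of P" if "v \<in> P" for v
      using face_of_linear_image_inj_on [OF f(1) inj _, of "{v}"] that poly
      by (simp add: face_of_singleton polytope_imp_convex)
    moreover have "v \<in> P" if "v extreme_point_of P" for v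
      using that by (simp add: extreme_point_of_def)
    moreover have "v \<in> f ` P" if "v extreme_point_of (f ` P)" for v
      using that by (simp add: extreme_point_of_def)
    ultimately show ?thesis by blast
  qed
  moreover have "card (f ` {v. v extreme_point_of P}) = n"
    using card inj by (subst card_image) (auto simp: extreme_point_of_def inj_on_def)
  moreover have "polytope (f ` P)"
    using poly f(1) by (simp add: polytope_linear_image)
  ultimately show ?thesis using dim by (simp add: convex_polygon_def)
qed

lemma convex_polygon_translation:
  "convex_polygon n ((+) c ` P) \<longleftrightarrow> convex_polygon n P"
  by (simp add: convex_polygon_def polytope_translation_eq aff_dim_translation_eq
      extreme_points_of_translation card_image)

lemma polytopal_complex_linear_image:
  fixes f :: "'a::euclidean_space \<Rightarrow> 'b::euclidean_space"
  assumes f: "linear f" "inj_on f (\<Union>K)" and K: "polytopal_complex K"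
  shows "polytopal_complex ((`) f ` K)" "combinatorially_isomorphic K ((`) f ` K)"
proof -
  have poly: "polytope S" if "S \<in> K" for S using K that by (auto simp: polytopal_complex_def)
  have inj: "inj_on f S" if "S \<in> K" for S using f(2) that by (meson Union_upper inj_on_subset)
  have face: "f ` T face_of f ` S \<longleftrightarrow> T face_of S" if "S \<in> K" "T \<subseteq> S" for S T
    by (rule face_of_linear_image_inj_on) (use f inj poly that in \<open>auto simp: polytope_imp_convex\<close>)
  show "polytopal_complex ((`) f ` K)"
    unfolding polytopal_complex_def
  proof (intro conjI)
    show "finite ((`) f ` K)" using K by (simp add: polytopal_complex_def)
    show "\<forall>S\<in>(`) f ` K. polytope S"
      using poly f(1) by (auto simp: polytope_linear_image)
    show "\<forall>S\<in>(`) f ` K. \<forall>F. F face_of S \<longrightarrow> F \<in> (`) f ` K"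
    proof (clarify)
      fix S F assume S: "S \<in> K" and F: "F face_of f ` S"
      \<comment> \<open>A face of the image is a subset of it, hence the image of some
        \<open>T\<close> in \<open>S\<close>, and \<open>T\<close> is a face by the converse
        direction of the transfer.\<close>
      obtain T where T: "T \<subseteq> S" "F = f ` T"
        using face_of_imp_subset [OF F] by (meson subset_imageE)
      then have "T face_of S" using face [OF S] F by simp
      then have "T \<in> K" using K S by (auto simp: polytopal_complex_def)
      then show "F \<in> (`) f ` K" using T by blast
    qed
    show "\<forall>S\<in>(`) f ` K. \<forall>T\<in>(`) f ` K. S \<inter> T face_of S \<and> S \<inter> T face_of T"
    proof clarify
      fix S T assume ST: "S \<in> K" "T \<in> K"
      have "f ` S \<inter> f ` T = f ` (S \<inter> T)"
        using inj_on_image_Int [OF f(2)] ST by (metis Union_upper)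
      then show "f ` S \<inter> f ` T face_of f ` S \<and> f ` S \<inter> f ` T face_of f ` T"
        using face [of S "S \<inter> T"] face [of T "S \<inter> T"] ST K
        by (simp add: polytopal_complex_def)
    qed
  qed
  have "f ` S \<subseteq> f ` T \<longleftrightarrow> S \<subseteq> T" if "S \<in> K" "T \<in> K" for S T
    using inj_on_image_subset_iff [OF f(2)] that by (meson Union_upper)
  moreover from this have "inj_on ((`) f) K"
    by (intro inj_onI) (simp add: set_eq_subset)
  ultimately show "combinatorially_isomorphic K ((`) f ` K)"
    unfolding combinatorially_isomorphic_def
    by (intro exI [of _ "(`) f"]) (simp add: bij_betw_def)
qed

section \<open>Graphs of affine maps\<close>

text \<open>Splits the graph of an affine map into a translate of an injective linear image, so that
  results on translations and linear maps apply.\<close>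

lemma graph_affine_eq_translation:
  "(\<lambda>x. (x, c + h x)) ` S = (+) (0, c) ` (\<lambda>x. (x, h x)) ` S" for c :: "'b::euclidean_space"
    and S :: "'a::euclidean_space set"
  by (simp add: image_image)

lemma linear_graph: "linear h \<Longrightarrow> linear (\<lambda>x. (x, h x))"
  by (rule linearI) (simp_all add: linear_add linear_scale)

lemma convex_polygon_graph:
  fixes h :: "'a::euclidean_space \<Rightarrow> 'b::euclidean_space"
  assumes "linear h" "convex_polygon n P"
  shows "convex_polygon n ((\<lambda>x. (x, c + h x)) ` P)"
  using assms unfolding graph_affine_eq_translation convex_polygon_translation
  by (intro convex_polygon_linear_image linear_graph) (auto simp: inj_on_def)

lemma rel_interior_graph:
  fixes h :: "'a::euclidean_space \<Rightarrow> 'b::euclidean_space"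
  assumes "linear h"
  shows "rel_interior ((\<lambda>x. (x, c + h x)) ` S) = (\<lambda>x. (x, c + h x)) ` rel_interior S"
  using assms unfolding graph_affine_eq_translation rel_interior_translation
  by (subst rel_interior_injective_linear_image)
    (auto simp: inj_on_def linear_graph linear_conv_bounded_linear [symmetric])

section \<open>The opposite vertices of a simplex\<close>

text \<open>A nonzero such \<open>y\<close> would be a recession direction: its whole ray from the
  origin would lie in the bounded polyhedron.\<close>

lemma bounded_hpolyhedron_recession:
  fixes b :: "nat \<Rightarrow> 'a::euclidean_space"
  assumes "bounded (hpolyhedron b q)" "\<And>i. i < q \<Longrightarrow> b i \<bullet> y \<le> 0"
  shows "y = 0"
proof (rule ccontr)
  assume "y \<noteq> 0"
  obtain B where B: "B > 0" "\<And>x. x \<in> hpolyhedron b q \<Longrightarrow> norm x \<le> B"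
    using assms(1) unfolding bounded_pos by blast
  \<comment> \<open>This factor gives the multiple of \<open>y\<close> norm \<open>B + 1\<close>,
    just beyond the bound.\<close>
  let ?t = "(B + 1) / norm y"
  have "?t \<ge> 0" using B(1) by simp
  have "b i \<bullet> (?t *\<^sub>R y) \<le> 1" if "i < q" for i
    using mult_nonneg_nonpos [OF \<open>?t \<ge> 0\<close> assms(2) [OF that]] by simp
  then have "?t *\<^sub>R y \<in> hpolyhedron b q" by (simp add: hpolyhedron_def)
  from B(2) [OF this] show False using \<open>y \<noteq> 0\<close> B(1) by simp
qed

text \<open>Every facet of a simplex is spanned by all vertices but one, and distinct facets omit
  distinct vertices. So the vertex omitted by facet \<open>j\<close> lies on all the other
  facets.\<close>

lemma simplex_opposite_vertex:
  fixes b :: "nat \<Rightarrow> 'a::euclidean_space"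
  assumes q: "q \<ge> 2" and simp: "n simplex (hpolyhedron b q)" and fac: "facet_inequalities b q"
    and j: "j < q"
  shows "\<exists>v. (\<forall>i<q. i \<noteq> j \<longrightarrow> b i \<bullet> v = 1) \<and> b j \<bullet> v < 1"
proof -
  obtain C where C: "\<not> affine_dependent C" "hpolyhedron b q = convex hull C"
    using simp by (auto simp: simplex_def)
  have bij: "bij_betw (hfacet b q) {..<q} {F. F facet_of convex hull C}"
    using fac C by (simp add: facet_inequalities_def)
  have "\<exists>u. u \<in> C \<and> hfacet b q i = convex hull (C - {u})" if "i < q" for i
  proof -
    have "hfacet b q i facet_of convex hull C"
      using bij_betwE [OF bij] that by auto
    then show ?thesis using facet_of_convex_hull_affine_independent [OF C(1)] by blast
  qed
  then obtain u where u: "\<And>i. i < q \<Longrightarrow> u i \<in> C"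
      "\<And>i. i < q \<Longrightarrow> hfacet b q i = convex hull (C - {u i})"
    by metis
  have bu: "b i \<bullet> u j = 1" if "i < q" "i \<noteq> j" for i
  proof -
    have "hfacet b q i \<noteq> hfacet b q j"
      using bij_betw_imp_inj_on [OF bij] that j by (auto dest: inj_onD)
    then have "u i \<noteq> u j" using u that j by auto
    then have "u j \<in> hfacet b q i" using u that j by (simp add: hull_inc)
    then show ?thesis by (simp add: hfacet_def)
  qed
  \<comment> \<open>Otherwise all \<open>b i \<bullet> u j\<close> would be at least 1 and
    \<open>- u j\<close> a recession direction, hence zero. As \<open>q \<ge> 2\<close>, some other
    facet gives \<open>b i \<bullet> u j = 1\<close>, a contradiction.\<close>
  have "b j \<bullet> u j < 1"
  proof (rule ccontr)
    assume "\<not> ?thesis"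
    then have "b i \<bullet> (- u j) \<le> 0" if "i < q" for i
      using bu that by (cases "i = j") auto
    moreover have "bounded (hpolyhedron b q)"
      using simp by (simp add: simplex_imp_polytope polytope_imp_bounded)
    ultimately have "- u j = 0" by (intro bounded_hpolyhedron_recession) auto
    moreover obtain i where "i < q" "i \<noteq> j" using q by (metis One_nat_def less_2_cases_iff
        less_le_trans one_neq_zero zero_less_two one_less_numeral_iff semiring_norm(76))
    ultimately show False using bu by force
  qed
  with bu show ?thesis by blast
qed

section \<open>The surface in the wedge product\<close>

text \<open>The factor \<open>1 - a k \<bullet> x\<close> in block \<open>k\<close> is chosen so
  that \<open>b l \<bullet> w k = 1\<close> puts every point of the section on the facet hyperplane
  with indices \<open>k\<close>, \<open>l\<close>. The inverse of \<open>e\<close> recovers the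
  block number from the index type.\<close>

definition wedge_section ::
  "(nat \<Rightarrow> 'p::finite) \<Rightarrow> nat \<Rightarrow> (nat \<Rightarrow> real^2) \<Rightarrow> (nat \<Rightarrow> real^'m) \<Rightarrow> real^2
    \<Rightarrow> (real^2) \<times> (real^'m^'p)" where
  "wedge_section e p a w x =
    (x, \<chi> r. (1 - a (inv_into {..<p} e r) \<bullet> x) *\<^sub>R w (inv_into {..<p} e r))"

lemma wedge_section_affine:
  obtains c h where "linear h" "wedge_section e p a w = (\<lambda>x. (x, c + h x))"
proof
  show "linear (\<lambda>x. \<chi> r. - (a (inv_into {..<p} e r) \<bullet> x) *\<^sub>R w (inv_into {..<p} e r))"
    by (rule linearI) (auto simp: vec_eq_iff inner_add_right algebra_simps)
  show "wedge_section e p a w = (\<lambda>x. (x, (\<chi> r. w (inv_into {..<p} e r)) +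
      (\<chi> r. - (a (inv_into {..<p} e r) \<bullet> x) *\<^sub>R w (inv_into {..<p} e r))))"
    by (auto simp: wedge_section_def vec_eq_iff fun_eq_iff algebra_simps)
qed

text \<open>In block \<open>k\<close> the equations for \<open>l \<noteq> j k\<close> determine
  \<open>y\<close> from \<open>x\<close>, and the one remaining inequality becomes
  \<open>a k \<bullet> x \<le> 1\<close>; so \<open>G\<close> lies in the graph. Conversely, the
  graph is a convex part of the wedge product whose relative interior meets the face
  \<open>G\<close>, which forces it into \<open>G\<close>.\<close>

lemma surface_polygon_eq_graph:
  fixes e :: "nat \<Rightarrow> 'p::finite" and a :: "nat \<Rightarrow> real^2" and b :: "nat \<Rightarrow> real^'m"
  assumes p: "p > 0" and e: "bij_betw e {..<p} UNIV"
    and bounded: "bounded (hpolyhedron b q)"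
    and v: "\<And>j. j < q \<Longrightarrow> (\<forall>i<q. i \<noteq> j \<longrightarrow> b i \<bullet> v j = 1) \<and> b j \<bullet> v j < 1"
    and G: "G face_of wedge_product e p q a b"
    and j: "\<And>k. k < p \<Longrightarrow> j k < q"
    and entry: "\<And>k. k < p \<Longrightarrow> face_entry e q a b G k = {..<q} - {j k}"
  shows "G = wedge_section e p a (\<lambda>k. v (j k)) ` hpolyhedron a p"
    (is "G = ?\<phi> ` _")
proof
  define i where "i = inv_into {..<p} e"
  have i: "i r < p" "e (i r) = r" for r
    using e inv_into_into [of r e "{..<p}"] f_inv_into_f [of r e "{..<p}"]
    by (auto simp: i_def bij_betw_def)
  have ie: "i (e k) = k" if "k < p" for k
    using e that by (auto simp: i_def bij_betw_def)
  have \<phi>: "?\<phi> x = (x, \<chi> r. (1 - a (i r) \<bullet> x) *\<^sub>R v (j (i r)))" for x by (simp add: i_def wedge_section_def)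
  have slack: "y $ e k = (1 - a k \<bullet> x) *\<^sub>R v (j k)"
      "a k \<bullet> x + b (j k) \<bullet> (y $ e k) \<le> 1"
    if xy: "(x, y) \<in> G" and k: "k < p" for x y k
  proof -
    have W: "a k \<bullet> x + b l \<bullet> (y $ e k) \<le> 1" if "l < q" for l
      using face_of_imp_subset [OF G] xy k that by (auto simp: wedge_product_def)
    have eq: "a k \<bullet> x + b l \<bullet> (y $ e k) = 1" if "l < q" "l \<noteq> j k" for l
    proof -
      have "l \<in> face_entry e q a b G k" using entry [OF k] that by simp
      then show ?thesis using xy by (auto simp: face_entry_def wedge_hyperplane_def)
    qed
    \<comment> \<open>The difference of two solutions of the block equations is orthogonal to every
      \<open>b l\<close> except possibly \<open>b (j k)\<close>. Whatever the sign of that last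
      product, \<open>z\<close> or \<open>- z\<close> is a recession direction of the bounded
      simplex.\<close>
    define z where "z = y $ e k - (1 - a k \<bullet> x) *\<^sub>R v (j k)"
    have z: "b l \<bullet> z = 0" if "l < q" "l \<noteq> j k" for l
      using eq [OF that] v [OF j [OF k]] that by (simp add: z_def inner_diff_right)
    have "z = 0"
    proof (cases "b (j k) \<bullet> z \<le> 0")
      case True
      then show ?thesis using z by (intro bounded_hpolyhedron_recession [OF bounded]) force
    next
      case False
      then have "- z = 0" using z by (intro bounded_hpolyhedron_recession [OF bounded]) force
      then show ?thesis by simp
    qed
    then show "y $ e k = (1 - a k \<bullet> x) *\<^sub>R v (j k)" by (simp add: z_def)
    show "a k \<bullet> x + b (j k) \<bullet> (y $ e k) \<le> 1" using W j k by blast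
  qed
  have fst_in: "x \<in> hpolyhedron a p" if xy: "(x, y) \<in> G" for x y
  proof -
    have "a k \<bullet> x \<le> 1" if k: "k < p" for k
    proof -
      \<comment> \<open>After substitution for \<open>y\<close> the remaining inequality factors.
        The second factor is positive, as \<open>v (j k)\<close> is off its opposite facet.\<close>
      have "(1 - a k \<bullet> x) * (1 - b (j k) \<bullet> v (j k)) \<ge> 0"
        using slack(2) [OF xy k] unfolding slack(1) [OF xy k] by (simp add: algebra_simps)
      moreover have "b (j k) \<bullet> v (j k) < 1" using v j k by blast
      ultimately show ?thesis by (simp add: zero_le_mult_iff)
    qed
    then show ?thesis by (simp add: hpolyhedron_def)
  qed
  have graph: "(x, y) = ?\<phi> x" if "(x, y) \<in> G" for x y
    using slack(1) [OF that i(1)] i(2) by (auto simp: \<phi> vec_eq_iff)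
  show sub: "G \<subseteq> ?\<phi> ` hpolyhedron a p"
    using graph fst_in by (auto simp: image_iff) blast
  show "?\<phi> ` hpolyhedron a p \<subseteq> G"
  proof (rule subset_of_face_of [OF G])
    show "?\<phi> ` hpolyhedron a p \<subseteq> wedge_product e p q a b"
    proof (rule image_subsetI)
      fix x assume x: "x \<in> hpolyhedron a p"
      have "a k \<bullet> x + b l \<bullet> ((1 - a k \<bullet> x) *\<^sub>R v (j k)) \<le> 1" if k: "k < p" and l: "l < q" for k l
      proof -
        have "b l \<bullet> v (j k) \<le> 1" using v [OF j [OF k]] l by (cases "l = j k") auto
        moreover have "1 - a k \<bullet> x \<ge> 0" using x k by (simp add: hpolyhedron_def)
        ultimately have "(1 - a k \<bullet> x) * (b l \<bullet> v (j k)) \<le> 1 - a k \<bullet> x"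
          by (simp add: mult_left_le)
        then show ?thesis by simp
      qed
      then show "?\<phi> x \<in> wedge_product e p q a b"
        unfolding \<phi> by (simp add: wedge_product_def ie)
    qed
    \<comment> \<open>Each slack is positive somewhere on \<open>G\<close>, so all are positive at the average of such points.\<close>
    have "\<exists>x \<in> fst ` G. a k \<bullet> x < 1" if k: "k < p" for k
    proof -
      have "j k \<notin> face_entry e q a b G k" using entry [OF k] by simp
      then obtain x y where xy: "(x, y) \<in> G" "a k \<bullet> x + b (j k) \<bullet> (y $ e k) \<noteq> 1"
        using j [OF k] by (auto simp: face_entry_def wedge_hyperplane_def)
      \<comment> \<open>If \<open>a k \<bullet> x = 1\<close>, block \<open>k\<close> of
        \<open>y\<close> would vanish and the point would lie on the excluded hyperplane.\<close>
      then have "a k \<bullet> x \<noteq> 1" using slack(1) [OF xy(1) k] by auto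
      moreover have "a k \<bullet> x \<le> 1" using fst_in [OF xy(1)] k by (simp add: hpolyhedron_def)
      ultimately show ?thesis using xy(1) by force
    qed
    then obtain g where g: "\<And>k. k < p \<Longrightarrow> g k \<in> fst ` G" "\<And>k. k < p \<Longrightarrow> a k \<bullet> g k < 1"
      by metis
    define x where "x = (\<Sum>k<p. (1 / real p) *\<^sub>R g k)"
    have "convex (fst ` G)"
      using face_of_imp_convex [OF G] by (intro convex_linear_image linear_fst)
    then have x: "x \<in> fst ` G"
      unfolding x_def using g(1) p by (intro convex_sum) auto
    then have \<phi>x: "?\<phi> x \<in> G" using graph by (metis (no_types, lifting) imageE prod.collapse)
    have "a k \<bullet> x < 1" if k: "k < p" for k
    proof -
      have le: "a k \<bullet> g l \<le> 1" if "l < p" for l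
        using fst_in g(1) [OF that] k by (fastforce simp: hpolyhedron_def)
      have "a k \<bullet> x = (\<Sum>l<p. a k \<bullet> g l) / real p"
        by (simp add: x_def inner_sum_right sum_divide_distrib)
      moreover have "(\<Sum>l<p. a k \<bullet> g l) < (\<Sum>l<p. 1)"
        using le g(2) [OF k] k by (intro sum_strict_mono_ex1) auto
      ultimately show ?thesis using p by simp
    qed
    \<comment> \<open>The strict inequalities cut out an open subset of the polygon, so
      \<open>x\<close> is an interior point. Its image under the section is then in the relative
      interior of the graph.\<close>
    moreover have "open {x. \<forall>k<p. a k \<bullet> x < 1}"
      using open_INT [of "{..<p}" "\<lambda>k. {x. a k \<bullet> x < 1}"]
      by (simp add: open_halfspace_lt Collect_ball_eq [symmetric] Ball_def)
    moreover have "{x. \<forall>k<p. a k \<bullet> x < 1} \<subseteq> hpolyhedron a p"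
      by (auto simp: hpolyhedron_def)
    ultimately have "x \<in> interior (hpolyhedron a p)"
      using interior_maximal by blast
    then have xr: "x \<in> rel_interior (hpolyhedron a p)"
      using interior_subset_rel_interior by blast
    have "?\<phi> x \<in> rel_interior (?\<phi> ` hpolyhedron a p)"
      by (rule wedge_section_affine [of e p a "\<lambda>k. v (j k)"]) (use xr in \<open>simp add: rel_interior_graph\<close>)
    then show "G \<inter> rel_interior (?\<phi> ` hpolyhedron a p) \<noteq> {}" using \<phi>x by blast
  qed
qed

text \<open>Serves two purposes: it bounds the number of polygons and gives each of them the shape
  of a graph. Restricting \<open>j\<close> to the indices below \<open>p\<close> makes the set of
  possible vectors finite.\<close>

lemma surface_polygons_subset_sections:
  fixes e :: "nat \<Rightarrow> 'p::finite" and a :: "nat \<Rightarrow> real^2" and b :: "nat \<Rightarrow> real^'m"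
  assumes "p > 0" "q \<ge> 2" "bij_betw e {..<p} UNIV"
    and simplex: "n simplex (hpolyhedron b q)" and fac: "facet_inequalities b q"
  obtains v where "surface_polygons e p q a b \<subseteq>
    (\<lambda>j. wedge_section e p a (\<lambda>k. v (j k)) ` hpolyhedron a p) ` ({..<p} \<rightarrow>\<^sub>E {..<q})"
proof -
  have "bounded (hpolyhedron b q)"
    using simplex by (simp add: simplex_imp_polytope polytope_imp_bounded)
  obtain v where v: "\<And>j. j < q \<Longrightarrow> (\<forall>i<q. i \<noteq> j \<longrightarrow> b i \<bullet> v j = 1) \<and> b j \<bullet> v j < 1"
    using simplex_opposite_vertex [OF \<open>q \<ge> 2\<close> simplex fac] by metis
  show thesis
  proof (rule that, rule subsetI)
    fix G assume "G \<in> surface_polygons e p q a b"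
    then obtain j where j: "G face_of wedge_product e p q a b" "\<And>k. k < p \<Longrightarrow> j k < q"
        "\<And>k. k < p \<Longrightarrow> face_entry e q a b G k = {..<q} - {j k}"
      unfolding surface_polygons_def by blast
    let ?j = "restrict j {..<p}"
    have "G = wedge_section e p a (\<lambda>k. v (?j k)) ` hpolyhedron a p"
      by (rule surface_polygon_eq_graph [OF assms(1,3) \<open>bounded _\<close> v j(1)]) (use j in auto)
    moreover have "?j \<in> {..<p} \<rightarrow>\<^sub>E {..<q}" using j(2) by auto
    ultimately show "G \<in> (\<lambda>j. wedge_section e p a (\<lambda>k. v (j k)) ` hpolyhedron a p) `
        ({..<p} \<rightarrow>\<^sub>E {..<q})" by blast
  qed
qed

section \<open>The surface as a polytopal complex and its projection to
  \<open>real^5\<close>\<close>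

theorem corollary3p9:
  fixes p q :: nat
    and a :: "nat \<Rightarrow> real^2"
    and b :: "nat \<Rightarrow> real^'m"
    and e :: "nat \<Rightarrow> 'p::finite"
  assumes "p \<ge> 3" and "q \<ge> 2"
    and "CARD('m) = q - 1"
    and "bij_betw e {..<p} UNIV"
    and "convex_polygon p (hpolyhedron a p)"
    and "facet_inequalities a p"
    and "cyclically_labeled a p"
    and "int (q - 1) simplex (hpolyhedron b q)"
    and "facet_inequalities b q"
  shows "\<exists>K :: (real^5) set set.
           polytopal_complex K \<and>
           (\<forall>S\<in>K. \<exists>P\<in>K. convex_polygon p P \<and> S face_of P) \<and>
           combinatorially_isomorphic (surface e p q a b) K"
proof -
  let ?G = "surface_polygons e p q a b" and ?K = "surface e p q a b"
  obtain v where v: "?G \<subseteq>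
      (\<lambda>j. wedge_section e p a (\<lambda>k. v (j k)) ` hpolyhedron a p) ` ({..<p} \<rightarrow>\<^sub>E {..<q})"
    using surface_polygons_subset_sections [of p q e] assms by (metis gr0I not_numeral_le_zero)
  have "finite ?G"
    by (rule finite_subset [OF v]) (simp add: finite_PiE)
  have polygon: "convex_polygon p G" if "G \<in> ?G" for G
  proof -
    obtain w where G: "G = wedge_section e p a w ` hpolyhedron a p"
      using v \<open>G \<in> ?G\<close> by fast
    show ?thesis
      unfolding G by (rule wedge_section_affine [of e p a w])
        (simp add: convex_polygon_graph assms)
  qed
  then have polytope: "polytope G" if "G \<in> ?G" for G
    using that by (simp add: convex_polygon_def)
  have self: "G \<in> ?K" if "G \<in> ?G" for G
    using that face_of_refl [OF polytope_imp_convex [OF polytope [OF that]]]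
    by (auto simp: surface_def)
  \<comment> \<open>All cells are faces of one convex set, so the intersection of two cells is again
    a face of it and thus of both cells.\<close>
  have face: "S face_of wedge_product e p q a b" if "S \<in> ?K" for S
    using that by (auto simp: surface_def surface_polygons_def intro: face_of_trans)
  have K: "polytopal_complex ?K"
    unfolding polytopal_complex_def
  proof (intro conjI ballI allI impI)
    have "?K = (\<Union>G\<in>?G. {F. F face_of G})" by (auto simp: surface_def)
    then show "finite ?K" using \<open>finite ?G\<close> polytope by (simp add: finite_polytope_faces)
    show "polytope S" if "S \<in> ?K" for S
      using that polytope face_of_polytope_polytope by (auto simp: surface_def)
    show "F \<in> ?K" if "S \<in> ?K" "F face_of S" for S F
      using that face_of_trans by (fastforce simp: surface_def)
    show "S \<inter> T face_of S" "S \<inter> T face_of T" if "S \<in> ?K" "T \<in> ?K" for S T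
      using face_of_Int [OF face [OF that(1)] face [OF that(2)]] face that
      by (auto intro: face_of_subset dest: face_of_imp_subset)
  qed
  have "aff_dim S \<le> int 2" if "S \<in> ?K" for S
  proof -
    obtain G where "G \<in> ?G" "S face_of G" using \<open>S \<in> ?K\<close> by (auto simp: surface_def)
    then show ?thesis
      using polygon [of G] aff_dim_subset [OF face_of_imp_subset, of S G]
      by (simp add: convex_polygon_def)
  qed
  \<comment> \<open>Cells have dimension at most 2, and \<open>2 * 2 + 1 = 5\<close>.\<close>
  then obtain f :: "(real^2) \<times> (real^'m^'p) \<Rightarrow> real^5"
    where f: "linear f" "inj_on f (\<Union>S\<in>?K. affine hull S)"
    using exists_linear_inj_on_affine_hulls [of ?K 2, where 'n=5] K
    by (auto simp: polytopal_complex_def)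
  have inj: "inj_on f (\<Union>?K)"
    by (rule inj_on_subset [OF f(2)]) (auto intro: hull_inc)
  show ?thesis
  proof (intro exI conjI ballI)
    show "polytopal_complex ((`) f ` ?K)" "combinatorially_isomorphic ?K ((`) f ` ?K)"
      by (rule polytopal_complex_linear_image [OF f(1) inj K])+
    fix S assume "S \<in> (`) f ` ?K"
    then obtain T G where T: "S = f ` T" "G \<in> ?G" "T face_of G" by (auto simp: surface_def)
    have "G \<in> ?K" by (rule self [OF T(2)])
    have "inj_on f (affine hull G)"
      by (rule inj_on_subset [OF f(2)]) (use \<open>G \<in> ?K\<close> in blast)
    then have "convex_polygon p (f ` G)"
      using convex_polygon_linear_image [OF f(1)] polygon T by blast
    moreover have "f ` T face_of f ` G"
      using face_of_linear_image_inj_on [OF f(1), of G T] T polytope inj \<open>G \<in> ?K\<close>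
      by (meson Union_upper face_of_imp_subset inj_on_subset polytope_imp_convex)
    ultimately show "\<exists>P\<in>(`) f ` ?K. convex_polygon p P \<and> S face_of P"
      using T(1) \<open>G \<in> ?K\<close> by blast
  qed
qed

end
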